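(* Let $m\ge 0$ and let $r=[r_0,\ldots,r_m]$ and $c=[c_0,\ldots,c_m]$ be strictly increasing sequences of nonnegative integers. Let $T_{r,c}$ be the $(m+1)\times(m+1)$ matrix whose $(i,j)$ entry is $\binom{c_j}{r_i}$, $0\le i,j\le m$. Then the following are equivalent: (1) $T_{r,c}$ is invertible; (2) $r\le c$, i.e. $r_i\le c_i$ for all $i=0,\ldots,m$; (3) no diagonal entry of $T_{r,c}$ is zero, i.e. $\binom{c_i}{r_i}\neq 0$ for all $i=0,\ldots,m$.
   Context: The infinite upper triangular Pascal matrix is $T=[\binom{j}{i}]_{i,j\ge 0}$, with the convention $\binom{j}{i}:=0$ if $i>j$. $T_{r,c}$ is the submatrix of $T$ formed by rows $r$ and columns $c$. Matrices are considered over the real numbers (invertible means nonzero determinant). *)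

theory Defs
  imports "Jordan_Normal_Form.Determinant"
begin

(* binomial already satisfies (j choose i) = 0 for i > j *)
definition pascal :: "nat \<Rightarrow> nat \<Rightarrow> real" where
  "pascal i j = real (j choose i)"

(* Only the values r 0, ..., r m and c 0, ..., c m matter. *)
definition pascal_sub :: "nat \<Rightarrow> (nat \<Rightarrow> nat) \<Rightarrow> (nat \<Rightarrow> nat) \<Rightarrow> real mat" where
  "pascal_sub m r c = mat (Suc m) (Suc m) (\<lambda>(i, j). pascal (r i) (c j))"

lemma pascal_sub_carrier: "pascal_sub m r c \<in> carrier_mat (Suc m) (Suc m)"
  by (simp add: pascal_sub_def)

(* Invertibility is expressed as a nonzero determinant; this agrees with invertible_mat. *)
lemma det_nonzero_iff_invertible_mat:
  fixes A :: "real mat"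
  assumes A: "A \<in> carrier_mat n n"
  shows "det A \<noteq> 0 \<longleftrightarrow> invertible_mat A"
proof
  assume "det A \<noteq> 0"
  from det_non_zero_imp_unit[OF A this, where b = "()"]
  obtain B where "B \<in> carrier_mat n n" "B * A = 1\<^sub>m n" "A * B = 1\<^sub>m n"
    by (auto simp: Units_def ring_mat_def)
  then show "invertible_mat A"
    using A by (auto simp: invertible_mat_def inverts_mat_def intro!: exI[of _ B])
next
  assume "invertible_mat A"
  then obtain B where 1: "A * B = 1\<^sub>m n" and 2: "B * A = 1\<^sub>m (dim_row B)"
    using A by (auto simp: invertible_mat_def inverts_mat_def)
  have "dim_col B = n" using arg_cong[OF 1, of dim_col] by simp
  moreover have "dim_row B = n" using arg_cong[OF 2, of dim_col] A by simp
  ultimately have B: "B \<in> carrier_mat n n" by auto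
  have "det A * det B = 1" using det_mult[OF A B] 1 by simp
  then show "det A \<noteq> 0" by auto
qed

end

theory Submission
  imports Defs
begin

text \<open>
  Minors of the Pascal matrix with increasing rows and columns are nonnegative, and positive when
  \<open>r \<le> c\<close>. Replacing each column by its difference with the previous one does not change the
  determinant, and by the hockey-stick identity the new entries are sums of \<open>k choose (r i - 1)\<close>
  over consecutive disjoint intervals of \<open>k\<close>. Multilinearity then writes the minor as a sum of
  minors with all rows lowered by one (if \<open>r 0 = 0\<close>, the first row is \<open>(1, 0, \<dots>, 0)\<close> and is
  expanded away), so induction on the largest row index applies. Conversely, \<open>c i < r i\<close> produces a
  zero block too large for any permutation to avoid.
\<close>

text \<open>Summing differences back up is right multiplication by the upper triangular matrix of
  ones, whose determinant is 1.\<close>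

lemma det_eq_det_column_differences:
  fixes f :: "nat \<Rightarrow> nat \<Rightarrow> 'a :: comm_ring_1"
  shows "det (mat n n (\<lambda>(i, j). f i j)) =
    det (mat n n (\<lambda>(i, j). f i j - (if j = 0 then 0 else f i (j - 1))))" (is "det ?A = det ?D")
proof -
  let ?U = "mat n n (\<lambda>(i, j). if i \<le> j then 1 else 0 :: 'a)"
  have tele: "(\<Sum>l\<le>j. f i l - (if l = 0 then 0 else f i (l - 1))) = f i j" for i j
    by (induction j) auto
  have "?A = ?D * ?U"
  proof (rule eq_matI)
    fix i j assume "i < dim_row (?D * ?U)" "j < dim_col (?D * ?U)"
    then have ij: "i < n" "j < n" by auto
    have "(?D * ?U) $$ (i, j) =
        (\<Sum>l\<in>{0..<n}. if l \<le> j then f i l - (if l = 0 then 0 else f i (l - 1)) else 0)"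
      using ij by (auto simp: scalar_prod_def intro!: sum.cong)
    also have "\<dots> = (\<Sum>l\<le>j. f i l - (if l = 0 then 0 else f i (l - 1)))"
      using ij by (intro sum.mono_neutral_cong_right) auto
    finally show "?A $$ (i, j) = (?D * ?U) $$ (i, j)" using ij tele by simp
  qed auto
  moreover have "det ?U = 1"
  proof -
    have "det ?U = prod_list (diag_mat ?U)"
      by (rule det_upper_triangular[of _ n]) (auto simp: upper_triangular_def)
    also have "diag_mat ?U = map (\<lambda>_. 1) [0..<n]"
      by (auto simp: diag_mat_def)
    finally show ?thesis by (simp add: map_replicate_const)
  qed
  ultimately show ?thesis
    by (simp add: det_mult[of _ n])
qed

lemma det_first_row_zero:
  fixes A :: "'a :: comm_ring_1 mat"
  assumes A: "A \<in> carrier_mat (Suc n) (Suc n)"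
    and zero: "\<And>j. 0 < j \<Longrightarrow> j \<le> n \<Longrightarrow> A $$ (0, j) = 0"
  shows "det A = A $$ (0, 0) * det (mat n n (\<lambda>(i, j). A $$ (Suc i, Suc j)))"
proof -
  have "det A = (\<Sum>j<Suc n. A $$ (0, j) * cofactor A 0 j)"
    using A by (intro laplace_expansion_row) auto
  also have "\<dots> = A $$ (0, 0) * cofactor A 0 0"
    by (subst sum.lessThan_Suc_shift) (simp add: zero)
  also have "mat_delete A 0 0 = mat n n (\<lambda>(i, j). A $$ (Suc i, Suc j))"
    using A by (auto simp: mat_delete_def)
  then have "cofactor A 0 0 = det (mat n n (\<lambda>(i, j). A $$ (Suc i, Suc j)))"
    by (simp add: cofactor_def)
  finally show ?thesis .
qed

text \<open>Multilinearity in all columns at once: in the Leibniz formula with one factor per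
  column, the product of sums expands over the choices \<open>\<kappa>\<close> of one summand per
  column.\<close>

lemma det_sum_columns:
  fixes f :: "nat \<Rightarrow> 'b \<Rightarrow> 'a :: comm_ring_1"
  assumes "\<And>j. j < n \<Longrightarrow> finite (K j)"
  shows "det (mat n n (\<lambda>(i, j). \<Sum>k\<in>K j. f i k)) =
    (\<Sum>\<kappa>\<in>Pi\<^sub>E {..<n} K. det (mat n n (\<lambda>(i, j). f i (\<kappa> j))))"
proof -
  let ?P = "{p. p permutes {0..<n}}"
  have perm_less: "p j < n" if "p \<in> ?P" "j < n" for p j
    using that permutes_in_image[of p "{0..<n}" j] by auto
  have "det (mat n n (\<lambda>(i, j). \<Sum>k\<in>K j. f i k)) =
      (\<Sum>p\<in>?P. signof p * (\<Prod>j<n. \<Sum>k\<in>K j. f (p j) k))"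
    by (subst det_col[of _ n]) (auto intro!: sum.cong prod.cong simp: perm_less)
  also have "\<dots> = (\<Sum>p\<in>?P. \<Sum>\<kappa>\<in>Pi\<^sub>E {..<n} K. signof p * (\<Prod>j<n. f (p j) (\<kappa> j)))"
    using assms by (subst prod_sum_PiE) (auto simp: sum_distrib_left)
  also have "\<dots> = (\<Sum>\<kappa>\<in>Pi\<^sub>E {..<n} K. \<Sum>p\<in>?P. signof p * (\<Prod>j<n. f (p j) (\<kappa> j)))"
    by (rule sum.swap)
  also have "\<dots> = (\<Sum>\<kappa>\<in>Pi\<^sub>E {..<n} K. det (mat n n (\<lambda>(i, j). f i (\<kappa> j))))"
    by (intro sum.cong refl, subst det_col[of _ n]) (auto intro!: sum.cong prod.cong simp: perm_less)
  finally show ?thesis .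
qed

text \<open>By pigeonhole, no permutation sends the \<open>i + 1\<close> columns
  \<open>0, ..., i\<close> into the \<open>i\<close> rows before row \<open>i\<close>, so each
  Leibniz term has a factor in the block.\<close>

lemma det_zero_block:
  fixes A :: "'a :: comm_ring_1 mat"
  assumes A: "A \<in> carrier_mat n n" and "i < n"
    and zero: "\<And>k l. i \<le> k \<Longrightarrow> k < n \<Longrightarrow> l \<le> i \<Longrightarrow> A $$ (k, l) = 0"
  shows "det A = 0"
proof -
  have "(\<Prod>j<n. A $$ (p j, j)) = 0" if p: "p permutes {0..<n}" for p
  proof -
    have "\<exists>l\<le>i. i \<le> p l"
    proof (rule ccontr)
      assume "\<not> (\<exists>l\<le>i. i \<le> p l)"
      then have "p ` {..i} \<subseteq> {..<i}" by force
      then have "card (p ` {..i}) \<le> i" using card_mono[of "{..<i}"] by fastforce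
      moreover have "card (p ` {..i}) = Suc i"
        using permutes_inj[OF p] by (simp add: card_image inj_on_subset)
      ultimately show False by simp
    qed
    then obtain l where l: "l \<le> i" "i \<le> p l" by blast
    moreover have "p l < n" using permutes_in_image[OF p, of l] l \<open>i < n\<close> by auto
    ultimately show ?thesis
      using zero[of "p l" l] \<open>i < n\<close> by (intro prod_zero bexI[of _ l]) auto
  qed
  then show ?thesis by (simp add: det_col[OF A])
qed

lemma sum_choose_atLeastLessThan:
  assumes "a \<le> b"
  shows "(\<Sum>k\<in>{a..<b}. real (k choose s)) = real (b choose Suc s) - real (a choose Suc s)"
  using assms by (induction b rule: dec_induct) auto

text \<open>The minors on the right-hand side of \<open>det_sum_columns\<close> all have increasing columns because the
  intervals are consecutive; the right endpoints give the positive one.\<close>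

lemma det_sum_intervals_choose:
  fixes s lo hi :: "nat \<Rightarrow> nat"
  assumes minor: "\<And>\<kappa>. strict_mono_on {..<n} \<kappa> \<Longrightarrow>
      0 \<le> det (mat n n (\<lambda>(i, j). real (\<kappa> j choose s i))) \<and>
      ((\<forall>i<n. s i \<le> \<kappa> i) \<longrightarrow> 0 < det (mat n n (\<lambda>(i, j). real (\<kappa> j choose s i))))"
    and sep: "\<And>i j. i < j \<Longrightarrow> j < n \<Longrightarrow> hi i \<le> lo j"
  defines "B \<equiv> mat n n (\<lambda>(i, j). \<Sum>k\<in>{lo j..<hi j}. real (k choose s i))"
  shows "0 \<le> det B"
    and "(\<And>j. j < n \<Longrightarrow> lo j < hi j \<and> s j < hi j) \<Longrightarrow> 0 < det B"
proof -
  let ?K = "Pi\<^sub>E {..<n} (\<lambda>j. {lo j..<hi j})"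
  let ?d = "\<lambda>\<kappa>. det (mat n n (\<lambda>(i, j). real (\<kappa> j choose s i)))"
  have B: "det B = sum ?d ?K"
    unfolding B_def by (rule det_sum_columns) simp
  have mono: "strict_mono_on {..<n} \<kappa>" if "\<kappa> \<in> ?K" for \<kappa>
  proof (rule strict_mono_onI)
    fix i j assume ij: "i \<in> {..<n}" "j \<in> {..<n}" "i < j"
    then have "\<kappa> i < hi i" "lo j \<le> \<kappa> j"
      using PiE_mem[OF that, of i] PiE_mem[OF that, of j] by auto
    with sep[of i j] ij show "\<kappa> i < \<kappa> j" by auto
  qed
  have nonneg: "0 \<le> ?d \<kappa>" if "\<kappa> \<in> ?K" for \<kappa>
    using minor[OF mono[OF that]] by blast
  show "0 \<le> det B" unfolding B by (rule sum_nonneg) (rule nonneg)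
  assume endpoints: "\<And>j. j < n \<Longrightarrow> lo j < hi j \<and> s j < hi j"
  define \<kappa> where "\<kappa> = (\<lambda>j\<in>{..<n}. hi j - 1)"
  have mem: "\<kappa> \<in> ?K"
    unfolding \<kappa>_def using endpoints by (intro restrict_PiE_iff[THEN iffD2]) fastforce
  have "\<forall>i<n. s i \<le> \<kappa> i" unfolding \<kappa>_def using endpoints by fastforce
  then have "0 < ?d \<kappa>" using minor[OF mono[OF mem]] by blast
  then show "0 < det B"
    unfolding B by (intro sum_pos2[OF _ mem]) (auto intro!: finite_PiE nonneg)
qed

text \<open>Both claims go through one induction: positivity of a sum of minors needs one positive
  term and nonnegativity of the others. The columns vary with the chosen summands and
  \<open>n\<close> may drop, so only the row bound \<open>N\<close> drives the induction.\<close>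

lemma pascal_minor_nonneg_pos:
  fixes r c :: "nat \<Rightarrow> nat"
  assumes "strict_mono_on {..<n} r" "strict_mono_on {..<n} c" "\<And>i. i < n \<Longrightarrow> r i < N"
  shows "0 \<le> det (mat n n (\<lambda>(i, j). real (c j choose r i))) \<and>
    ((\<forall>i<n. r i \<le> c i) \<longrightarrow> 0 < det (mat n n (\<lambda>(i, j). real (c j choose r i))))"
  using assms
proof (induction N arbitrary: n r c)
  case 0
  \<comment> \<open>No row index lies below 0, so the matrix is empty and its determinant is
    1.\<close>
  then have "n = 0" by fastforce
  then show ?case by simp
next
  case (Suc N)
  note r_less = strict_mono_onD[OF Suc.prems(1)] and c_less = strict_mono_onD[OF Suc.prems(2)]
  have c_le: "c i \<le> c j" if "i \<le> j" "j < n" for i j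
    using c_less[of i j] that by (cases "i = j") auto
  let ?A = "mat n n (\<lambda>(i, j). real (c j choose r i))"
  let ?D = "mat n n (\<lambda>(i, j). real (c j choose r i) -
      (if j = 0 then 0 else real (c (j - 1) choose r i)))"
  have AD: "det ?A = det ?D" by (rule det_eq_det_column_differences)
  show ?case
  proof (cases "n = 0 \<or> 0 < r 0")
    case True
    have r_pos: "0 < r i" if "i < n" for i
      using True r_less[of 0 i] that by (cases "i = 0") auto
    define s where "s i = r i - 1" for i
    have r_Suc: "r i = Suc (s i)" if "i < n" for i using r_pos[OF that] by (simp add: s_def)
    \<comment> \<open>Column 0 has no predecessor; starting its interval at 0 is correct because
      \<open>0 choose Suc (s i)\<close> vanishes.\<close>
    define lo where "lo j = (if j = 0 then 0 else c (j - 1))" for j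
    have "strict_mono_on {..<n} s"
      by (rule strict_mono_onI) (use r_less r_Suc in fastforce)
    moreover have "s i < N" if "i < n" for i using Suc.prems(3)[OF that] r_Suc[OF that] by simp
    ultimately have minor: "0 \<le> det (mat n n (\<lambda>(i, j). real (\<kappa> j choose s i))) \<and>
      ((\<forall>i<n. s i \<le> \<kappa> i) \<longrightarrow> 0 < det (mat n n (\<lambda>(i, j). real (\<kappa> j choose s i))))"
      if "strict_mono_on {..<n} \<kappa>" for \<kappa>
      using Suc.IH that by blast
    have sep: "c i \<le> lo j" if "i < j" "j < n" for i j
      using that by (auto simp: lo_def intro!: c_le)
    have lo_le: "lo j \<le> c j" if "j < n" for j
      using that by (auto simp: lo_def intro!: c_le)
    have D: "?D = mat n n (\<lambda>(i, j). \<Sum>k\<in>{lo j..<c j}. real (k choose s i))"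
      by (rule eq_matI) (auto simp: sum_choose_atLeastLessThan lo_le r_Suc, auto simp: lo_def)
    \<comment> \<open>For \<open>j = 0\<close> the interval is nonempty because
      \<open>0 < r 0\<close> and \<open>r 0 \<le> c 0\<close>.\<close>
    have "lo j < c j \<and> s j < c j" if "\<forall>i<n. r i \<le> c i" "j < n" for j
      using that r_Suc[of j] c_less[of "j - 1" j] by (auto simp: lo_def)
    then show ?thesis
      unfolding AD D using det_sum_intervals_choose[of n s c lo, OF minor sep] by blast
  next
    case False
    then obtain n' where n: "n = Suc n'" and r0: "r 0 = 0" by (cases n) auto
    define s where "s i = r (Suc i) - 1" for i
    have r_Suc: "r (Suc i) = Suc (s i)" if "i < n'" for i
      using r_less[of 0 "Suc i"] that n by (simp add: s_def)
    have "strict_mono_on {..<n'} s"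
    proof (rule strict_mono_onI)
      fix i j assume "i \<in> {..<n'}" "j \<in> {..<n'}" "i < j"
      then show "s i < s j" using r_less[of "Suc i" "Suc j"] r_Suc n by simp
    qed
    moreover have "s i < N" if "i < n'" for i
      using Suc.prems(3)[of "Suc i"] r_Suc[OF that] n that by simp
    ultimately have minor: "0 \<le> det (mat n' n' (\<lambda>(i, j). real (\<kappa> j choose s i))) \<and>
      ((\<forall>i<n'. s i \<le> \<kappa> i) \<longrightarrow> 0 < det (mat n' n' (\<lambda>(i, j). real (\<kappa> j choose s i))))"
      if "strict_mono_on {..<n'} \<kappa>" for \<kappa>
      using Suc.IH that by blast
    \<comment> \<open>Deleting column 0 shifts the indices: column \<open>j\<close> is now the
      difference of the original columns \<open>Suc j\<close> and \<open>j\<close>, so every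
      interval has a genuine left endpoint \<open>c j\<close>.\<close>
    let ?B = "mat n' n' (\<lambda>(i, j). \<Sum>k\<in>{c j..<c (Suc j)}. real (k choose s i))"
    have sep: "c (Suc i) \<le> c j" if "i < j" "j < n'" for i j
      using that n by (intro c_le) auto
    have "det ?D = ?D $$ (0, 0) * det (mat n' n' (\<lambda>(i, j). ?D $$ (Suc i, Suc j)))"
      by (rule det_first_row_zero) (auto simp: n r0)
    also have "mat n' n' (\<lambda>(i, j). ?D $$ (Suc i, Suc j)) = ?B"
      by (rule eq_matI) (auto simp: sum_choose_atLeastLessThan c_le r_Suc n)
    finally have D: "det ?D = det ?B" by (simp add: n r0)
    have "c j < c (Suc j) \<and> s j < c (Suc j)" if "\<forall>i<n. r i \<le> c i" "j < n'" for j
      using that(1)[rule_format, of "Suc j"] that(2) r_Suc[of j] c_less[of j "Suc j"] n by auto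
    then show ?thesis
      unfolding AD D using det_sum_intervals_choose[of n' s "\<lambda>j. c (Suc j)" c, OF minor sep] by blast
  qed
qed

theorem theorem1p1:
  fixes m :: nat and r c :: "nat \<Rightarrow> nat"
  assumes "strict_mono_on {0..m} r" and "strict_mono_on {0..m} c"
  shows "(det (pascal_sub m r c) \<noteq> 0 \<longleftrightarrow> (\<forall>i\<in>{0..m}. r i \<le> c i)) \<and>
         ((\<forall>i\<in>{0..m}. r i \<le> c i) \<longleftrightarrow> (\<forall>i\<in>{0..m}. pascal_sub m r c $$ (i, i) \<noteq> 0))"
proof (intro conjI iffI)
  have set_eq: "{0..m} = {..<Suc m}" by auto
  have sub: "pascal_sub m r c = mat (Suc m) (Suc m) (\<lambda>(i, j). real (c j choose r i))"
    by (simp add: pascal_sub_def pascal_def)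
  have r_le: "r i \<le> r j" if "i \<le> j" "j \<le> m" for i j
    using strict_mono_onD[OF assms(1), of i j] that by (cases "i = j") auto
  have c_le: "c i \<le> c j" if "i \<le> j" "j \<le> m" for i j
    using strict_mono_onD[OF assms(2), of i j] that by (cases "i = j") auto
  \<comment> \<open>The largest row index is \<open>r m\<close>, so \<open>Suc (r m)\<close> serves
    as the strict bound.\<close>
  show "det (pascal_sub m r c) \<noteq> 0" if "\<forall>i\<in>{0..m}. r i \<le> c i"
    using pascal_minor_nonneg_pos[of "Suc m" r c "Suc (r m)"] assms that r_le
    unfolding sub set_eq by (simp add: less_Suc_eq_le)
  show "\<forall>i\<in>{0..m}. r i \<le> c i" if det: "det (pascal_sub m r c) \<noteq> 0"
  proof (rule ccontr)
    assume "\<not> (\<forall>i\<in>{0..m}. r i \<le> c i)"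
    then obtain i where i: "i \<le> m" "c i < r i" by auto
    have "det (pascal_sub m r c) = 0"
    proof (rule det_zero_block[OF pascal_sub_carrier])
      show "i < Suc m" using i by simp
      \<comment> \<open>Monotonicity spreads the single failure over the block:
        \<open>c l \<le> c i < r i \<le> r k\<close>.\<close>
      fix k l assume "i \<le> k" "k < Suc m" "l \<le> i"
      then show "pascal_sub m r c $$ (k, l) = 0"
        using r_le[of i k] c_le[of l i] i by (simp add: sub binomial_eq_0)
    qed
    with det show False by simp
  qed
  show "\<forall>i\<in>{0..m}. pascal_sub m r c $$ (i, i) \<noteq> 0" if "\<forall>i\<in>{0..m}. r i \<le> c i"
    using that by (auto simp: sub not_less)
  show "\<forall>i\<in>{0..m}. r i \<le> c i" if "\<forall>i\<in>{0..m}. pascal_sub m r c $$ (i, i) \<noteq> 0"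
    using that by (auto simp: sub not_less)
qed

end
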